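(* Let $f=\sum_\alpha a_\alpha X^\alpha\in\mathbb{R}[X_1,\dots,X_n]$ with $\deg f=d>0$ and homogeneous components $f_0,\dots,f_d$, and let $c_d>0$ be such that $f_d(x)\ge c_d$ for all $x\in\mathbb{S}^{n-1}_2$. Put $$c_j:=-\|f_j\|_1,\qquad j=1,\dots,d-1,$$ let $R\in[0,\infty)$ be the largest nonnegative real root of $q(\lambda)=\sum_{j=1}^d c_j\lambda^j$, and let $$R_{\mathrm{lit}}:=\max\Bigl(1,\ \frac{1}{c_d}\sum_{j=1}^{d-1}\|f_j\|_1\Bigr)=\max\Bigl(1,\ \frac1{c_d}\sum_{0<|\alpha|<d}|a_\alpha|\Bigr)\in[1,\infty).$$ Then $R\le R_{\mathrm{lit}}$. If moreover $d>2$ and there is a coefficient $a_\alpha\neq0$ of $f$ with $|\alpha|<d-1$, then $R<R_{\mathrm{lit}}$ for $R\neq1$, and $R=R_{\mathrm{lit}}$ for $R=1$.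
   Context: For a multi-index $\alpha\in\mathbb{N}_0^n$, $|\alpha|=\alpha_1+\dots+\alpha_n$ and $X^\alpha=X_1^{\alpha_1}\cdots X_n^{\alpha_n}$. The homogeneous components of $f$ are $f_j=\sum_{|\alpha|=j}a_\alpha X^\alpha$. For a polynomial $g=\sum_\alpha b_\alpha X^\alpha$, $\|g\|_1:=\sum_\alpha|b_\alpha|$. $\mathbb{S}^{n-1}_2$ is the Euclidean unit sphere in $\mathbb{R}^n$.
   Formalization: The strict inequality R < R_lit is stated for a nonzero coefficient with 0 < |α| < d−1; with only the constant term below degree d−1 it is false (X⁴+5X³+1, c_4 = 1: R = R_lit = 5), and for R < 1 it still follows from R_lit ≥ 1. *)

theory Defs
  imports "HOL-Analysis.Analysis" "HOL-Library.Poly_Mapping"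
    "HOL-Computational_Algebra.Polynomial"
begin

text \<open>
  A polynomial in the variables indexed by the finite type \<open>'n\<close> is a finitely supported map
  from multi-indices to coefficients: \<open>lookup f \<alpha>\<close> is the coefficient of \<open>X\<^sup>\<alpha>\<close> and \<open>keys f\<close> is
  the finite set of multi-indices with nonzero coefficient.
\<close>

type_synonym 'n multi_index = "'n \<Rightarrow>\<^sub>0 nat"
type_synonym 'n real_mpoly = "'n multi_index \<Rightarrow>\<^sub>0 real"

definition mi_deg :: "('n::finite) multi_index \<Rightarrow> nat" where
  "mi_deg \<alpha> = (\<Sum>i\<in>UNIV. Poly_Mapping.lookup \<alpha> i)"

text \<open>The zero polynomial gets degree 0.\<close>

definition total_deg :: "('n::finite) real_mpoly \<Rightarrow> nat" where
  "total_deg f = Max (insert 0 (mi_deg ` Poly_Mapping.keys f))"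

definition hom_comp :: "('n::finite) real_mpoly \<Rightarrow> nat \<Rightarrow> 'n real_mpoly" where
  "hom_comp f j = (\<Sum>\<alpha> | \<alpha> \<in> Poly_Mapping.keys f \<and> mi_deg \<alpha> = j. Poly_Mapping.single \<alpha> (Poly_Mapping.lookup f \<alpha>))"

definition mpoly_eval :: "('n::finite) real_mpoly \<Rightarrow> real ^ 'n \<Rightarrow> real" where
  "mpoly_eval f x = (\<Sum>\<alpha>\<in>Poly_Mapping.keys f. Poly_Mapping.lookup f \<alpha> * (\<Prod>i\<in>UNIV. (x $ i) ^ Poly_Mapping.lookup \<alpha> i))"

definition coeff_norm1 :: "('n::finite) real_mpoly \<Rightarrow> real" where
  "coeff_norm1 g = (\<Sum>\<alpha>\<in>Poly_Mapping.keys g. \<bar>Poly_Mapping.lookup g \<alpha>\<bar>)"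

text \<open>The argument \<open>cd\<close> is the lower bound of the leading form on the Euclidean unit sphere.\<close>

definition R_lit :: "('n::finite) real_mpoly \<Rightarrow> real \<Rightarrow> real" where
  "R_lit f cd = max 1 (1 / cd * (\<Sum>j = 1..total_deg f - 1. coeff_norm1 (hom_comp f j)))"

end

theory Submission
  imports Defs
begin

text \<open>
  Write \<open>N\<^sub>j\<close> for the coefficient norm of \<open>f\<^sub>j\<close>. That \<open>R\<close> is a root of \<open>q\<close> is the balance
  \<open>c\<^sub>d R\<^sup>d = \<Sum>\<^bsub>0<j<d\<^esub> N\<^sub>j R\<^sup>j\<close>. If \<open>R > 1\<close>, every power \<open>R\<^sup>j\<close> on the right is at most \<open>R\<^bsup>d-1\<^esup>\<close>;
  dividing by \<open>c\<^sub>d R\<^bsup>d-1\<^esup>\<close> bounds \<open>R\<close> by \<open>(\<Sum>\<^bsub>0<j<d\<^esub> N\<^sub>j) / c\<^sub>d\<close>. The estimate loses something as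
  soon as a term with \<open>0 < j < d-1\<close> has positive weight, and this gives strictness
  (\<open>balance_root_le\<close>, \<open>balance_root_less\<close>). If \<open>R < 1\<close>, the lower bound \<open>1\<close> built into \<open>R_lit\<close>
  already wins strictly, and if \<open>R = 1\<close>, the balance says that both arguments of the maximum in
  \<open>R_lit\<close> are \<open>1\<close>. Grouping the monomials of \<open>f\<close> by degree
  (\<open>sum_coeff_norm1_hom_comp\<close>) identifies the two forms of \<open>R_lit\<close>.

  Only monomials of positive degree can produce strictness: for \<open>f = X\<^sup>4 + 5X\<^sup>3 + 1\<close> in one variable
  and \<open>c\<^sub>4 = 1\<close>, both \<open>R\<close> and \<open>R_lit\<close> are \<open>5\<close>, although the constant coefficient is nonzero.
\<close>

lemma lookup_hom_comp:
  "Poly_Mapping.lookup (hom_comp f j) \<alpha> = (if mi_deg \<alpha> = j then Poly_Mapping.lookup f \<alpha> else 0)"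
proof -
  have fin: "finite {\<beta> \<in> Poly_Mapping.keys f. mi_deg \<beta> = j}"
    by simp
  have "Poly_Mapping.lookup (hom_comp f j) \<alpha> =
      (\<Sum>\<beta> | \<beta> \<in> Poly_Mapping.keys f \<and> mi_deg \<beta> = j. if \<beta> = \<alpha> then Poly_Mapping.lookup f \<beta> else 0)"
    by (simp add: hom_comp_def lookup_sum lookup_single when_def)
  also have "\<dots> = (if mi_deg \<alpha> = j then Poly_Mapping.lookup f \<alpha> else 0)"
    using fin by (auto simp: sum.delta in_keys_iff)
  finally show ?thesis .
qed

lemma keys_hom_comp:
  "Poly_Mapping.keys (hom_comp f j) = {\<alpha> \<in> Poly_Mapping.keys f. mi_deg \<alpha> = j}"
  by (auto simp: in_keys_iff lookup_hom_comp split: if_splits)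

lemma coeff_norm1_hom_comp:
  "coeff_norm1 (hom_comp f j) =
    (\<Sum>\<alpha> | \<alpha> \<in> Poly_Mapping.keys f \<and> mi_deg \<alpha> = j. \<bar>Poly_Mapping.lookup f \<alpha>\<bar>)"
  by (simp add: coeff_norm1_def keys_hom_comp lookup_hom_comp)

lemma coeff_norm1_nonneg: "coeff_norm1 g \<ge> 0"
  by (simp add: coeff_norm1_def sum_nonneg)

lemma coeff_norm1_hom_comp_pos:
  assumes "Poly_Mapping.lookup f \<alpha> \<noteq> 0"
  shows "coeff_norm1 (hom_comp f (mi_deg \<alpha>)) > 0"
  unfolding coeff_norm1_hom_comp
  by (rule sum_pos2[of _ \<alpha>]) (use assms in \<open>auto simp: in_keys_iff\<close>)

lemma sum_coeff_norm1_hom_comp: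
  assumes "finite J"
  shows "(\<Sum>j\<in>J. coeff_norm1 (hom_comp f j)) =
    (\<Sum>\<alpha> | \<alpha> \<in> Poly_Mapping.keys f \<and> mi_deg \<alpha> \<in> J. \<bar>Poly_Mapping.lookup f \<alpha>\<bar>)"
proof -
  let ?K = "{\<alpha> \<in> Poly_Mapping.keys f. mi_deg \<alpha> \<in> J}"
  have "(\<Sum>j\<in>J. coeff_norm1 (hom_comp f j)) =
      (\<Sum>j\<in>J. \<Sum>\<alpha> | \<alpha> \<in> ?K \<and> mi_deg \<alpha> = j. \<bar>Poly_Mapping.lookup f \<alpha>\<bar>)"
    unfolding coeff_norm1_hom_comp by (intro sum.cong refl) auto
  also have "\<dots> = (\<Sum>\<alpha>\<in>?K. \<bar>Poly_Mapping.lookup f \<alpha>\<bar>)"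
    by (rule sum.group) (use assms in auto)
  finally show ?thesis .
qed

text \<open>
  For \<open>x \<ge> 1\<close> the largest power dominates, so the right side of the balance is at most
  \<open>x\<^bsup>d-1\<^esup>\<close> times the sum of the weights; cancel \<open>x\<^bsup>d-1\<^esup>\<close>.
\<close>

lemma balance_root_le:
  fixes x :: real
  assumes "d > 0" and "c > 0" and "x \<ge> 1"
    and nonneg: "\<And>j. j \<in> {1..d - 1} \<Longrightarrow> a j \<ge> 0"
    and balance: "c * x ^ d = (\<Sum>j = 1..d - 1. a j * x ^ j)"
  shows "x \<le> 1 / c * (\<Sum>j = 1..d - 1. a j)"
proof -
  have "(c * x) * x ^ (d - 1) = (\<Sum>j = 1..d - 1. a j * x ^ j)"
    using balance power_minus_mult[of d x] \<open>d > 0\<close> by (simp add: ac_simps)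
  also have "\<dots> \<le> (\<Sum>j = 1..d - 1. a j * x ^ (d - 1))"
    using nonneg \<open>x \<ge> 1\<close> by (intro sum_mono mult_left_mono power_increasing) auto
  also have "\<dots> = (\<Sum>j = 1..d - 1. a j) * x ^ (d - 1)"
    by (simp add: sum_distrib_right)
  finally have "c * x \<le> (\<Sum>j = 1..d - 1. a j)"
    using \<open>x \<ge> 1\<close> by simp
  then show ?thesis
    using \<open>c > 0\<close> by (simp add: field_simps)
qed

text \<open>
  A positive weight below the top degree \<open>d - 1\<close> makes the same comparison of powers strict.
\<close>

lemma balance_root_less:
  fixes x :: real
  assumes "c > 0" and "x > 1"
    and nonneg: "\<And>j. j \<in> {1..d - 1} \<Longrightarrow> a j \<ge> 0"
    and balance: "c * x ^ d = (\<Sum>j = 1..d - 1. a j * x ^ j)"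
    and k: "0 < k" "k < d - 1" "a k > 0"
  shows "x < 1 / c * (\<Sum>j = 1..d - 1. a j)"
proof -
  have "(c * x) * x ^ (d - 1) = (\<Sum>j = 1..d - 1. a j * x ^ j)"
    using balance power_minus_mult[of d x] k by (simp add: ac_simps)
  also have "\<dots> < (\<Sum>j = 1..d - 1. a j * x ^ (d - 1))"
  proof (rule sum_strict_mono_ex1)
    show "\<forall>j\<in>{1..d - 1}. a j * x ^ j \<le> a j * x ^ (d - 1)"
      using nonneg \<open>x > 1\<close> by (intro ballI mult_left_mono power_increasing) auto
    show "\<exists>j\<in>{1..d - 1}. a j * x ^ j < a j * x ^ (d - 1)"
      using k \<open>x > 1\<close> by (intro bexI[of _ k]) auto
  qed simp
  also have "\<dots> = (\<Sum>j = 1..d - 1. a j) * x ^ (d - 1)"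
    by (simp add: sum_distrib_right)
  finally have "c * x < (\<Sum>j = 1..d - 1. a j)"
    using \<open>x > 1\<close> by simp
  then show ?thesis
    using \<open>c > 0\<close> by (simp add: field_simps)
qed

theorem proposition8:
  fixes f :: "('n::finite) real_mpoly"
    and d :: nat
    and c :: "nat \<Rightarrow> real"
    and q :: "real poly"
    and R :: real
  assumes deg: "total_deg f = d" "d > 0"
    and cd_pos: "c d > 0"
    and cd_bound: "\<forall>x \<in> sphere 0 1. mpoly_eval (hom_comp f d) x \<ge> c d"
    and c_lower: "\<forall>j \<in> {1..d - 1}. c j = - coeff_norm1 (hom_comp f j)"
    and q_eq: "q = (\<Sum>j = 1..d. monom (c j) j)"
    and R_root: "R \<ge> 0" "poly q R = 0"
    and R_largest: "\<forall>t \<ge> 0. poly q t = 0 \<longrightarrow> t \<le> R"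
  shows "R_lit f (c d) = max 1 (1 / c d * (\<Sum>\<alpha> | \<alpha> \<in> Poly_Mapping.keys f \<and> 0 < mi_deg \<alpha> \<and> mi_deg \<alpha> < d. \<bar>Poly_Mapping.lookup f \<alpha>\<bar>))
    \<and> R_lit f (c d) \<ge> 1
    \<and> R \<le> R_lit f (c d)
    \<and> (d > 2 \<and> (\<exists>\<alpha>. Poly_Mapping.lookup f \<alpha> \<noteq> 0 \<and> 0 < mi_deg \<alpha> \<and> mi_deg \<alpha> < d - 1) \<longrightarrow>
         R \<noteq> 1 \<longrightarrow> R < R_lit f (c d))
    \<and> (d > 2 \<and> (\<exists>\<alpha>. Poly_Mapping.lookup f \<alpha> \<noteq> 0 \<and> mi_deg \<alpha> < d - 1) \<longrightarrow>
         R = 1 \<longrightarrow> R = R_lit f (c d))"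
proof -
  define N where "N j = coeff_norm1 (hom_comp f j)" for j
  define S where "S = (\<Sum>j = 1..d - 1. N j)"
  have lit: "R_lit f (c d) = max 1 (1 / c d * S)"
    by (simp add: R_lit_def deg S_def N_def)
  have N_nonneg: "N j \<ge> 0" for j
    by (simp add: N_def coeff_norm1_nonneg)
  have balance: "c d * R ^ d = (\<Sum>j = 1..d - 1. N j * R ^ j)"
  proof -
    have "poly q R = (\<Sum>j = 1..d. c j * R ^ j)"
      by (simp add: q_eq poly_sum poly_monom)
    also have "{1..d} = insert d {1..d - 1}"
      using deg(2) by auto
    also have "(\<Sum>j\<in>insert d {1..d - 1}. c j * R ^ j) = c d * R ^ d + (\<Sum>j = 1..d - 1. c j * R ^ j)"
      by (rule sum.insert) (use deg(2) in auto)
    also have "(\<Sum>j = 1..d - 1. c j * R ^ j) = - (\<Sum>j = 1..d - 1. N j * R ^ j)"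
      by (simp add: c_lower N_def sum_negf)
    finally show ?thesis
      using R_root(2) by simp
  qed

  have monomials: "S = (\<Sum>\<alpha> | \<alpha> \<in> Poly_Mapping.keys f \<and> 0 < mi_deg \<alpha> \<and> mi_deg \<alpha> < d.
      \<bar>Poly_Mapping.lookup f \<alpha>\<bar>)"
    unfolding S_def N_def
    by (subst sum_coeff_norm1_hom_comp) (auto intro!: sum.cong)

  have le: "R \<le> R_lit f (c d)"
  proof (cases "R \<ge> 1")
    case True
    then have "R \<le> 1 / c d * S"
      unfolding S_def using deg(2) cd_pos N_nonneg balance by (intro balance_root_le)
    then show ?thesis
      by (simp add: lit)
  qed (simp add: lit)

  have less: "R < R_lit f (c d)"
    if "Poly_Mapping.lookup f \<alpha> \<noteq> 0" "0 < mi_deg \<alpha>" "mi_deg \<alpha> < d - 1" "R \<noteq> 1" for \<alpha>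
  proof (cases "R > 1")
    case True
    have "N (mi_deg \<alpha>) > 0"
      unfolding N_def using that(1) by (rule coeff_norm1_hom_comp_pos)
    then have "R < 1 / c d * S"
      unfolding S_def using cd_pos True N_nonneg balance that(2,3)
      by (intro balance_root_less[where k = "mi_deg \<alpha>"])
    then show ?thesis
      by (simp add: lit)
  next
    case False
    then show ?thesis
      using that(4) by (simp add: lit)
  qed

  have eq: "R = R_lit f (c d)" if "R = 1"
  proof -
    have "S = c d"
      using balance that by (simp add: S_def)
    then show ?thesis
      using cd_pos that by (simp add: lit)
  qed

  have "R_lit f (c d) \<ge> 1"
    by (simp add: lit)
  then show ?thesis
    using lit[unfolded monomials] le less eq by blast
qed

end
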